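(* For every $2$-coloring of the edges of $K_{\mathbb{N}}$ there exists a monochromatic path $P$ with $\bar{d}(P)\geq 3/4$.
   Context: $K_{\mathbb{N}}$ is the complete graph with vertex set the positive integers $\mathbb{N}$ (with their natural order). An $r$-coloring of a graph is a partition of its edge set into $r$ classes (colors). A path in $K_{\mathbb{N}}$ is an infinite sequence $(x_1,x_2,\dots)$ of distinct positive integers together with the edges $x_nx_{n+1}$, $n\in\mathbb{N}$; it is monochromatic if all these edges have the same color. For $A\subseteq\mathbb{N}$, the upper density is $\bar{d}(A)=\limsup_{n\to\infty}|A\cap\{1,\dots,n\}|/n$, and the upper density of a subgraph is the upper density of its vertex set. *)

theory Defs
  imports Complex_Main "HOL-Library.Ramsey" "HOL-Library.FuncSet" "HOL-Library.Extended_Real"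
begin

text \<open>Natural numbers here start at 1, so 0 is not a vertex.\<close>

definition KN_vertices :: "nat set"
  where "KN_vertices = {1..}"

definition KN_edges :: "nat set set"
  where "KN_edges = nsets KN_vertices 2"

text \<open>A partition of an edge set into \<open>r\<close> colour classes, given by its class function;
  a class may be empty.\<close>

definition edge_coloring :: "nat \<Rightarrow> 'a set set \<Rightarrow> ('a set \<Rightarrow> nat) \<Rightarrow> bool"
  where "edge_coloring r E c \<longleftrightarrow> c \<in> E \<rightarrow> {..<r}"

text \<open>The term \<open>x\<^sub>n\<close> of a path \<open>(x\<^sub>1, x\<^sub>2, \<dots>)\<close> is \<open>x (n - 1)\<close>. Consecutive terms are
  automatically adjacent, since the host graph is complete.\<close>

definition KN_path :: "(nat \<Rightarrow> nat) \<Rightarrow> bool"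
  where "KN_path x \<longleftrightarrow> inj x \<and> range x \<subseteq> KN_vertices"

definition path_vertices :: "(nat \<Rightarrow> 'a) \<Rightarrow> 'a set"
  where "path_vertices x = range x"

definition path_edges :: "(nat \<Rightarrow> 'a) \<Rightarrow> 'a set set"
  where "path_edges x = range (\<lambda>n. {x n, x (Suc n)})"

definition monochromatic_edges :: "('a set \<Rightarrow> nat) \<Rightarrow> 'a set set \<Rightarrow> bool"
  where "monochromatic_edges c F \<longleftrightarrow> (\<exists>k. \<forall>e\<in>F. c e = k)"

definition upper_density :: "nat set \<Rightarrow> ereal"
  where "upper_density A = limsup (\<lambda>n. ereal (real (card (A \<inter> {1..n})) / real n))"

end

theory Submission
  imports Defs "HOL-Library.Diagonal_Subsequence" "HOL-Library.Sublist"
begin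

text \<open>Fix a sequence \<open>d\<close> such that every vertex is joined to almost all \<open>d i\<close> in one colour, and
  give the vertex that colour. Two vertices of colour \<open>k\<close> have infinitely many common neighbours
  in colour \<open>k\<close>, so disjoint paths of colour \<open>k\<close> whose ends have colour \<open>k\<close> can be linked; it
  suffices to find, for arbitrarily large \<open>n\<close>, such a path forest covering \<open>(3/4 - \<epsilon>) n\<close> of
  \<open>{1..n}\<close> and avoiding a given finite set.

  Let \<open>r n\<close> and \<open>b n\<close> count the red and blue vertices up to \<open>n\<close>. If \<open>r m = b n = s\<close>, the
  bipartite graph between the red vertices up to \<open>m\<close> and the blue vertices up to \<open>n\<close> contains a
  red forest absorbing \<open>x\<close> blue vertices and a blue forest absorbing \<open>y\<close> red ones with
  \<open>x + y \<ge> s - O(1)\<close>. Adding all remaining red vertices to the former and all remaining blue ones to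
  the latter, either \<open>r n + x\<close> is about \<open>3/4 n\<close> or \<open>b m + y\<close> is about \<open>3/4 m\<close>, provided that
  \<open>3 n \<le> m + 4 r n\<close>. If \<open>r n = b n\<close> for arbitrarily large \<open>n\<close>, take
  \<open>m = n\<close>. Otherwise let red be the minority from some point on and choose \<open>n\<close> so that \<open>\<rho> = r n / n\<close> is almost
  maximal; then \<open>m / n \<ge> (1 - \<rho>) / \<rho>\<close> up to an error, and this is at least \<open>3 - 4 \<rho>\<close> because
  \<open>(2 \<rho> - 1)\<^sup>2 \<ge> 0\<close>.\<close>

section \<open>Cohesive sequences by diagonalisation\<close>

text \<open>For fixed \<open>v\<close>, every sequence has a subsequence along which
  \<open>Q v\<close> is constant. The tail of the diagonal sequence after index \<open>v\<close> is
  a subsequence of one chosen for \<open>v\<close>, so \<open>Q v\<close> is constant on it.\<close>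

lemma exists_cohesive_sequence:
  fixes Q :: "nat \<Rightarrow> nat \<Rightarrow> bool"
  shows "\<exists>d. strict_mono d \<and> (\<forall>v. (\<forall>\<^sub>F i in sequentially. Q v (d i)) \<or> (\<forall>\<^sub>F i in sequentially. \<not> Q v (d i)))"
proof -
  let ?P = "\<lambda>v (s :: nat \<Rightarrow> nat). (\<forall>i. Q v (s i)) \<or> (\<forall>i. \<not> Q v (s i))"
  interpret subseqs ?P
  proof
    fix v :: nat and s :: "nat \<Rightarrow> nat"
    show "\<exists>r. strict_mono (r :: nat \<Rightarrow> nat) \<and> ?P v (s \<circ> r)"
    proof (cases "infinite {i. Q v (s i)}")
      case True
      then obtain r where r: "strict_mono (r :: nat \<Rightarrow> nat)" "\<forall>i. r i \<in> {i. Q v (s i)}"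
        using infinite_enumerate[OF True] by blast
      show ?thesis
        by (rule exI[of _ r]) (use r in simp)
    next
      case False
      then have "infinite (- {i. Q v (s i)})"
        by (metis finite_compl infinite_UNIV_nat)
      from infinite_enumerate[OF this]
      obtain r where r: "strict_mono (r :: nat \<Rightarrow> nat)" "\<forall>i. r i \<in> - {i. Q v (s i)}"
        by blast
      show ?thesis
        by (rule exI[of _ r]) (use r in simp)
    qed
  qed
  have P: "?P v (diagseq \<circ> (+) (Suc v))" for v
    by (rule diagseq_holds) auto
  have ev: "\<forall>\<^sub>F i in sequentially. R (diagseq i)" if "\<forall>i. R ((diagseq \<circ> (+) (Suc v)) i)" for R v
  proof (rule eventually_sequentiallyI)
    fix i assume "Suc v \<le> i"
    then show "R (diagseq i)"
      using that[rule_format, of "i - Suc v"] by simp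
  qed
  have "(\<forall>\<^sub>F i in sequentially. Q v (diagseq i)) \<or> (\<forall>\<^sub>F i in sequentially. \<not> Q v (diagseq i))" for v
    using P[of v]
  proof
    assume "\<forall>i. Q v ((diagseq \<circ> (+) (Suc v)) i)"
    then show ?thesis
      using ev[of "Q v" v] by (intro disjI1)
  next
    assume "\<forall>i. \<not> Q v ((diagseq \<circ> (+) (Suc v)) i)"
    then show ?thesis
      using ev[of "\<lambda>w. \<not> Q v w" v] by (intro disjI2)
  qed
  then show ?thesis
    using subseq_diagseq by (intro exI[of _ diagseq] conjI allI)
qed

section \<open>Depth-first search and alternating paths\<close>

text \<open>The state of a depth-first search on \<open>V\<close>: unvisited vertices \<open>U\<close>, current stack \<open>P\<close>,
  finished vertices \<open>D\<close>.\<close>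

definition dfs_state :: "('a \<Rightarrow> 'a \<Rightarrow> bool) \<Rightarrow> 'a set \<Rightarrow> 'a set \<Rightarrow> 'a list \<Rightarrow> 'a set \<Rightarrow> bool"
  where "dfs_state Q V U P D \<longleftrightarrow> V = U \<union> set P \<union> D \<and> set P \<inter> D = {} \<and> set P \<inter> U = {} \<and> D \<inter> U = {} \<and>
    distinct P \<and> successively Q P \<and> (\<forall>u\<in>U. \<forall>v\<in>D. \<not> Q u v)"

text \<open>Each step changes \<open>card (U \<inter> C) - card (D \<inter> A)\<close> by at most one, so the search passes
  through a balanced state.\<close>

lemma dfs_balanced_state:
  assumes "finite V" "dfs_state Q V U P D" "card (D \<inter> A) \<le> card (U \<inter> C)"
  shows "\<exists>U P D. dfs_state Q V U P D \<and> card (D \<inter> A) = card (U \<inter> C)"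
  using assms(2,3)
\<comment> \<open>A push takes one vertex from \<open>U\<close> and lengthens the stack by one, a
  pop only shortens the stack; the weight 2 makes the measure drop in both cases.\<close>
proof (induction "2 * card U + length P" arbitrary: U D P rule: less_induct)
  case less
  have fin: "finite U" "finite D"
    using assms(1) less.prems(1) by (auto simp: dfs_state_def)
  show ?case
  proof (cases "card (D \<inter> A) = card (U \<inter> C)")
    case True
    then show ?thesis
      using less.prems by blast
  next
    case False
    have push: ?thesis if u: "u \<in> U" "successively Q (u # P)" for u
    proof (rule less.hyps)
      have "(U - {u}) \<inter> C = U \<inter> C - {u}"
        by auto
      then have "card (U \<inter> C) \<le> Suc (card ((U - {u}) \<inter> C))"
        by (simp add: card_Diff_singleton_if) linarith
      then show "card (D \<inter> A) \<le> card ((U - {u}) \<inter> C)"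
        using False less.prems(2) by linarith
      have "card U > 0" "card (U - {u}) = card U - 1"
        using u fin by (auto simp: card_gt_0_iff)
      then show "2 * card (U - {u}) + length (u # P) < 2 * card U + length P"
        by simp
      show "dfs_state Q V (U - {u}) (u # P) D"
        using less.prems(1) u unfolding dfs_state_def by auto
    qed
    show ?thesis
    proof (cases P)
      case Nil
      \<comment> \<open>The inequality is strict here, so \<open>U\<close> still meets
        \<open>C\<close> and the empty stack can be restarted: the search cannot end before the
        balance is reached.\<close>
      have "card (U \<inter> C) \<noteq> 0"
        using False less.prems(2) by linarith
      then obtain u where "u \<in> U"
        by fastforce
      then show ?thesis
        using Nil push[of u] by simp
    next
      case (Cons v P0)
      show ?thesis
      proof (cases "\<exists>u\<in>U. Q u v")
        case True
        then obtain u where "u \<in> U" "Q u v"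
          by blast
        moreover have "successively Q P"
          using less.prems(1) by (simp add: dfs_state_def)
        ultimately show ?thesis
          using push[of u] Cons by simp
      next
        case noedge: False
        show ?thesis
        proof (rule less.hyps)
          have "card (insert v D \<inter> A) \<le> Suc (card (D \<inter> A))"
            using fin by (simp add: Int_insert_left card_insert_if)
          then show "card (insert v D \<inter> A) \<le> card (U \<inter> C)"
            using False less.prems(2) by linarith
          show "2 * card U + length P0 < 2 * card U + length P"
            using Cons by simp
          show "dfs_state Q V U P0 (insert v D)"
            using less.prems(1) noedge Cons unfolding dfs_state_def
            by (auto simp: successively_Cons)
        qed
      qed
    qed
  qed
qed

lemma alternating_count:
  assumes "successively (\<lambda>u v. u \<in> A \<longleftrightarrow> v \<notin> A) P"
  shows "\<bar>int (length (filter (\<lambda>v. v \<in> A) P)) - int (length (filter (\<lambda>v. v \<notin> A) P))\<bar> \<le> 1"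
proof -
  let ?f = "\<lambda>P. int (length (filter (\<lambda>v. v \<in> A) P)) - int (length (filter (\<lambda>v. v \<notin> A) P))"
  \<comment> \<open>Strengthened for the induction: whether the head lies in \<open>A\<close>
    determines which of the two sides may be ahead by one.\<close>
  have "if P = [] then ?f P = 0 else if hd P \<in> A then ?f P \<in> {0, 1} else ?f P \<in> {-1, 0}"
    using assms by (induction P) (auto simp: successively_Cons split: if_splits)
  then show ?thesis
    by (auto split: if_splits)
qed

text \<open>In an alternating list the neighbour of a vertex outside \<open>A\<close> lies in
  \<open>A\<close>, so dropping at most one vertex at each end suffices; this accounts for the
  \<open>+ 2\<close>.\<close>

lemma trim_alternating:
  assumes "successively (\<lambda>u v. u \<in> A \<longleftrightarrow> v \<notin> A) P" "distinct P" "set P \<subseteq> A \<union> C" "A \<inter> C = {}"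
  shows "\<exists>P'. sublist P' P \<and> (P' \<noteq> [] \<longrightarrow> hd P' \<in> A \<and> last P' \<in> A) \<and> card (set P \<inter> C) \<le> card (set P' \<inter> C) + 2"
proof -
  define P1 where "P1 = (if P \<noteq> [] \<and> hd P \<notin> A then tl P else P)"
  define P2 where "P2 = (if P1 \<noteq> [] \<and> last P1 \<notin> A then butlast P1 else P1)"
  have s1: "sublist P1 P"
    unfolding P1_def by auto
  have s2: "sublist P2 P1"
    unfolding P2_def by auto
  have alt1: "successively (\<lambda>u v. u \<in> A \<longleftrightarrow> v \<notin> A) P1"
    unfolding P1_def using assms(1) by (cases P) (auto simp: successively_Cons)
  have hd1: "hd P1 \<in> A" if "P1 \<noteq> []"
    using that assms(1) unfolding P1_def by (cases P) (auto simp: successively_Cons split: if_splits)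
  have ends2: "hd P2 \<in> A \<and> last P2 \<in> A" if "P2 \<noteq> []"
  proof (cases "P1 = [] \<or> last P1 \<in> A")
    case True
    then show ?thesis
      using that hd1 unfolding P2_def by auto
  next
    case False
    then have *: "P1 = P2 @ [last P1]"
      unfolding P2_def by simp
    then have "successively (\<lambda>u v. u \<in> A \<longleftrightarrow> v \<notin> A) (P2 @ [last P1])"
      using alt1 by simp
    then have "last P2 \<in> A"
      using that False by (auto simp: successively_append_iff)
    moreover have "hd P2 = hd P1"
      using * that by (metis hd_append2)
    ultimately show ?thesis
      using hd1 False by auto
  qed
  have "set P \<subseteq> insert (hd P) (set P1)"
    unfolding P1_def by (cases P) auto
  moreover have "set P1 \<subseteq> insert (last P1) (set P2)"
    unfolding P2_def by (cases P1 rule: rev_cases) auto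
  ultimately have "set P \<inter> C \<subseteq> insert (hd P) (insert (last P1) (set P2 \<inter> C))"
    by auto
  then have "card (set P \<inter> C) \<le> card (insert (hd P) (insert (last P1) (set P2 \<inter> C)))"
    by (intro card_mono) auto
  also have "\<dots> \<le> card (set P2 \<inter> C) + 2"
    by (simp add: card_insert_if)
  finally show ?thesis
    using s1 s2 ends2 sublist_order.order_trans by blast
qed

section \<open>Choosing the initial segments\<close>

lemma balanced_index:
  fixes r b :: "nat \<Rightarrow> nat"
  assumes sum: "\<And>n. r n + b n = n" and mono: "mono r" "mono b" and eps: "\<epsilon> > 0" and N: "N > 0"
    and lt: "\<And>n. n \<ge> N \<Longrightarrow> r n < b n" and quarter: "\<And>n. n \<ge> N \<Longrightarrow> real n < 4 * real (r n)"
  shows "\<exists>n m. N \<le> n \<and> n \<le> m \<and> r m = b n \<and> 3 * real n \<le> real m + 4 * real (r n) + \<epsilon> * real n"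
proof -
  define \<rho> where "\<rho> n = real (r n) / real n" for n
  define p where "p = (SUP n\<in>{N..}. \<rho> n)"
  have le1: "\<rho> n \<le> 1" for n
    unfolding \<rho>_def using sum[of n] by (simp add: divide_le_eq)
  then have bdd: "bdd_above (\<rho> ` {N..})"
    by (intro bdd_aboveI2)
  \<comment> \<open>Chosen so that \<open>3 * \<delta> = \<epsilon> / 4\<close>, which is at most
    \<open>\<epsilon> * t\<close> for \<open>t \<ge> 1 / 4\<close>; this absorbs the error of
    near-maximality below.\<close>
  define \<delta> where "\<delta> = \<epsilon> / 12"
  have "p - \<delta> < p"
    using eps by (simp add: \<delta>_def)
  then obtain n where n: "n \<ge> N" "p - \<delta> < \<rho> n"
    unfolding p_def using less_cSUP_iff[OF _ bdd] by auto
  have "\<exists>m\<ge>n. r m = b n"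
  proof -
    \<comment> \<open>By \<open>quarter\<close> at \<open>4 * n\<close>, \<open>r (4 * n)\<close>
      exceeds \<open>n\<close>, hence \<open>b n\<close>. As \<open>r\<close> grows by at most one
      per step, it takes the value \<open>b n\<close> in between.\<close>
    have unb: "b n \<le> r (4 * n)"
      using quarter[of "4 * n"] n sum[of n] by linarith
    have "r n \<le> b n"
      using lt[of n] n by simp
    have "\<exists>m. n \<le> m \<and> m \<le> 4 * n \<and> int (r m) = int (b n)"
    proof (rule nat_intermed_int_val)
      show "\<forall>i. n \<le> i \<and> i < 4 * n \<longrightarrow> \<bar>int (r (Suc i)) - int (r i)\<bar> \<le> 1"
      proof (intro allI impI)
        fix i
        have "r i \<le> r (Suc i)" "b i \<le> b (Suc i)"
          using monoD[OF mono(1), of i "Suc i"] monoD[OF mono(2), of i "Suc i"] by auto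
        then show "\<bar>int (r (Suc i)) - int (r i)\<bar> \<le> 1"
          using sum[of i] sum[of "Suc i"] by linarith
      qed
    qed (use unb \<open>r n \<le> b n\<close> in auto)
    then show ?thesis
      by auto
  qed
  then obtain m where m: "m \<ge> n" "r m = b n"
    by blast
  have pos: "real n > 0" "real m > 0"
    using n m N by auto
  have "\<rho> m \<le> p"
    unfolding p_def using n m by (intro cSUP_upper bdd) auto
  then have "\<rho> m \<le> \<rho> n + \<delta>"
    using n by linarith
  then have 1: "real n * (1 - \<rho> n) \<le> real m * (\<rho> n + \<delta>)"
  proof -
    have "real n * (1 - \<rho> n) = real n - real (r n)"
      unfolding \<rho>_def using pos by (simp add: right_diff_distrib)
    also have "\<dots> = real (b n)"
      using sum[of n] by linarith
    also have "\<dots> = real m * \<rho> m"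
      unfolding \<rho>_def using pos m by simp
    also have "\<dots> \<le> real m * (\<rho> n + \<delta>)"
      using \<open>\<rho> m \<le> \<rho> n + \<delta>\<close> by (intro mult_left_mono) auto
    finally show ?thesis .
  qed
  have q: "1 / 4 \<le> \<rho> n"
    unfolding \<rho>_def using quarter[of n] n pos by (simp add: field_simps)
  have "(3 - 4 * t - \<epsilon>) * (t + \<delta>) \<le> 1 - t" if t: "1 / 4 \<le> t" for t
  proof -
    have "(3 - 4 * t - \<epsilon>) * (t + \<delta>) = 3 * t - 4 * (t * t) - \<epsilon> * t + \<epsilon> / 4 - \<epsilon> * t / 3 - \<epsilon> * \<epsilon> / 12"
      by (simp add: \<delta>_def algebra_simps)
    moreover have "0 \<le> (2 * t - 1)\<^sup>2"
      by simp
    then have "0 \<le> 4 * (t * t) - 4 * t + 1"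
      by (simp add: power2_eq_square algebra_simps)
    moreover have "\<epsilon> * (1 / 4) \<le> \<epsilon> * t"
      using t eps by (intro mult_left_mono) auto
    moreover have "0 \<le> \<epsilon> * t" "0 \<le> \<epsilon> * \<epsilon>"
      using t eps by auto
    ultimately show ?thesis
      by linarith
  qed
  from this[OF q] have "real n * ((3 - 4 * \<rho> n - \<epsilon>) * (\<rho> n + \<delta>)) \<le> real n * (1 - \<rho> n)"
    by (intro mult_left_mono) auto
  with 1 have "(real n * (3 - 4 * \<rho> n - \<epsilon>)) * (\<rho> n + \<delta>) \<le> real m * (\<rho> n + \<delta>)"
    unfolding mult.assoc by (rule order_trans[rotated])
  moreover have "\<rho> n + \<delta> > 0"
    using q eps by (simp add: \<delta>_def)
  ultimately have "real n * (3 - 4 * \<rho> n - \<epsilon>) \<le> real m"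
    by (rule mult_right_le_imp_le)
  moreover have "real n * \<rho> n = real (r n)"
    unfolding \<rho>_def using pos by simp
  moreover have "real n * (3 - 4 * \<rho> n - \<epsilon>) = 3 * real n - 4 * (real n * \<rho> n) - \<epsilon> * real n"
    by (simp add: algebra_simps)
  ultimately have "3 * real n \<le> real m + 4 * real (r n) + \<epsilon> * real n"
    by linarith
  then show ?thesis
    using n m by blast
qed

text \<open>When the first two alternatives fail, no class fills three quarters of an initial
  segment, which gives the hypothesis \<open>quarter\<close> of \<open>balanced_index\<close>. The
  last two treat either class as the minority.\<close>

lemma balanced_index_cases:
  fixes r b :: "nat \<Rightarrow> nat"
  assumes sum: "\<And>n. r n + b n = n" and mono: "mono r" "mono b" and eps: "\<epsilon> > 0" and N: "N > 0"
  shows "(\<exists>n\<ge>N. 3 * real n \<le> 4 * real (r n)) \<or> (\<exists>n\<ge>N. 3 * real n \<le> 4 * real (b n)) \<or>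
    (\<exists>n m. N \<le> n \<and> n \<le> m \<and> r m = b n \<and> 3 * real n \<le> real m + 4 * real (r n) + \<epsilon> * real n) \<or>
    (\<exists>n m. N \<le> n \<and> n \<le> m \<and> b m = r n \<and> 3 * real n \<le> real m + 4 * real (b n) + \<epsilon> * real n)"
proof (cases "\<exists>n\<ge>N. r n = b n")
  case True
  then obtain n where n: "n \<ge> N" "r n = b n"
    by blast
  have "real n = 2 * real (r n)"
    using sum[of n] n by linarith
  then have "3 * real n \<le> real n + 4 * real (r n) + \<epsilon> * real n"
    using eps by simp
  then show ?thesis
    using n by blast
next
  case False
  have step: "r n \<le> r (Suc n)" "r (Suc n) \<le> Suc (r n)" "b n \<le> b (Suc n)" "b (Suc n) \<le> Suc (b n)" for n
    using monoD[OF mono(1), of n "Suc n"] monoD[OF mono(2), of n "Suc n"] sum[of n] sum[of "Suc n"]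
    by linarith+
  have quarter: "3 * real n \<le> 4 * real (b n) \<or> real n < 4 * real (r n)"
    "3 * real n \<le> 4 * real (r n) \<or> real n < 4 * real (b n)" for n
    using sum[of n] by linarith+
  from False have "r N \<noteq> b N"
    by blast
  then consider "r N < b N" | "b N < r N"
    by linarith
  then show ?thesis
  proof cases
    case 1
    \<comment> \<open>The counts grow by at most one per step, so the order cannot be reversed
      without passing through equality, which is excluded.\<close>
    have lt: "r n < b n" if "n \<ge> N" for n
      using that
    proof (induction n rule: dec_induct)
      case (step n)
      then show ?case
        using False \<open>\<And>n. r (Suc n) \<le> Suc (r n)\<close>[of n] \<open>\<And>n. b n \<le> b (Suc n)\<close>[of n]
        by (metis Suc_leI le_Suc_eq le_less_trans nless_le order_trans)
    qed (use 1 in simp)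
    show ?thesis
      using balanced_index[of r b \<epsilon> N, OF sum mono eps N lt] quarter(1) by blast
  next
    case 2
    have lt: "b n < r n" if "n \<ge> N" for n
      using that
    proof (induction n rule: dec_induct)
      case (step n)
      then show ?case
        using False \<open>\<And>n. b (Suc n) \<le> Suc (b n)\<close>[of n] \<open>\<And>n. r n \<le> r (Suc n)\<close>[of n]
        by (metis Suc_leI le_Suc_eq le_less_trans nless_le order_trans)
    qed (use 2 in simp)
    have "b n + r n = n" for n
      using sum[of n] by simp
    then show ?thesis
      using balanced_index[of b r \<epsilon> N, OF _ mono(2,1) eps N lt] quarter(2) by blast
  qed
qed

section \<open>Vertex colours, segments and forests\<close>

locale cohesive_coloring =
  fixes c :: "nat set \<Rightarrow> nat" and d :: "nat \<Rightarrow> nat"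
  assumes color_less: "\<lbrakk>0 < u; 0 < v; u \<noteq> v\<rbrakk> \<Longrightarrow> c {u, v} < 2"
    and strict_mono_d: "strict_mono d"
    and cohesive: "(\<forall>\<^sub>F i in sequentially. c {v, d i} = 0) \<or> (\<forall>\<^sub>F i in sequentially. c {v, d i} \<noteq> 0)"
begin

definition color_class :: "nat \<Rightarrow> nat set"
  where "color_class k = {v. 0 < v \<and> (\<forall>\<^sub>F i in sequentially. c {v, d i} = k)}"

lemma eventually_avoid: "finite W \<Longrightarrow> \<forall>\<^sub>F i in sequentially. d i \<notin> W"
  using finite_vimageI[of W d] strict_mono_imp_inj_on[OF strict_mono_d]
  by (simp add: cofinite_eq_sequentially[symmetric] eventually_cofinite vimage_def)

lemma color_class_disjoint:
  assumes "k \<noteq> l"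
  shows "color_class k \<inter> color_class l = {}"
proof -
  have False if "\<forall>\<^sub>F i in sequentially. c {v, d i} = k" "\<forall>\<^sub>F i in sequentially. c {v, d i} = l" for v
  proof -
    have "\<forall>\<^sub>F i in sequentially. False"
      using that by eventually_elim (use assms in simp)
    then show False
      by simp
  qed
  then show ?thesis
    by (auto simp: color_class_def)
qed

lemma zero_notin_color_class: "0 \<notin> color_class k"
  by (simp add: color_class_def)

lemma color_class_cover: "color_class 0 \<union> color_class 1 = {0<..}"
proof -
  have "v \<in> color_class 0 \<union> color_class 1" if "0 < v" for v
  proof (cases "\<forall>\<^sub>F i in sequentially. c {v, d i} = 0")
    case True
    then show ?thesis
      using that by (simp add: color_class_def)
  next
    case False
    then have "\<forall>\<^sub>F i in sequentially. c {v, d i} \<noteq> 0"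
      using cohesive by blast
    \<comment> \<open>Nothing is known about \<open>c {v, d i}\<close> when \<open>d i\<close> is 0
      or \<open>v\<close>; this happens for only finitely many \<open>i\<close>.\<close>
    moreover have "\<forall>\<^sub>F i in sequentially. d i \<notin> {0, v}"
      by (rule eventually_avoid) simp
    ultimately have "\<forall>\<^sub>F i in sequentially. c {v, d i} = 1"
    proof eventually_elim
      case (elim i)
      then show ?case
        using color_less[of v "d i"] that by auto
    qed
    then show ?thesis
      using that by (simp add: color_class_def)
  qed
  then show ?thesis
    by (auto simp: color_class_def)
qed

definition segment :: "nat \<Rightarrow> nat list \<Rightarrow> bool"
  where "segment k P \<longleftrightarrow> distinct P \<and> 0 \<notin> set P \<and> successively (\<lambda>u v. c {u, v} = k) P \<and>
    (P \<noteq> [] \<longrightarrow> hd P \<in> color_class k \<and> last P \<in> color_class k)"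

text \<open>A disjoint union of segments, recorded only by its vertex set: counting and absorption
  refer to nothing else.\<close>

inductive forest :: "nat \<Rightarrow> nat set \<Rightarrow> bool" for k
  where
    empty: "forest k {}"
  | add: "\<lbrakk>forest k F; segment k P; set P \<inter> F = {}\<rbrakk> \<Longrightarrow> forest k (set P \<union> F)"

lemma segment_singleton: "v \<in> color_class k \<Longrightarrow> segment k [v]"
  by (auto simp: segment_def color_class_def)

text \<open>Almost all \<open>d i\<close> are joined in colour \<open>k\<close> to both
  \<open>last P\<close> and \<open>hd q\<close>, so one of them can serve as a link.
  \<open>W\<close> keeps the link off vertices reserved for later; \<open>P\<close> stays a prefix
  so that iteration has a limit.\<close>

lemma segment_join:
  assumes P: "segment k P" and q: "segment k q" and disj: "set P \<inter> set q = {}" and W: "finite W"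
  shows "\<exists>P'. segment k P' \<and> prefix P P' \<and> set P \<union> set q \<subseteq> set P' \<and> set P' \<inter> W \<subseteq> set P \<union> set q"
proof (cases "P = [] \<or> q = []")
  case True
  then show ?thesis
    using P q by auto
next
  case False
  then have ends: "last P \<in> color_class k" "hd q \<in> color_class k"
    using P q by (auto simp: segment_def)
  have "\<forall>\<^sub>F i in sequentially. c {last P, d i} = k \<and> c {hd q, d i} = k \<and> d i \<notin> set P \<union> set q \<union> W \<union> {0}"
    using ends W by (intro eventually_conj eventually_avoid) (auto simp: color_class_def)
  then obtain i where i: "c {last P, d i} = k" "c {hd q, d i} = k" "d i \<notin> set P \<union> set q \<union> W \<union> {0}"
    using eventually_happens'[OF sequentially_bot] by blast
  define P' where "P' = P @ d i # q"
  have "c {d i, hd q} = k"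
    using i(2) by (simp add: insert_commute)
  then have "segment k P'"
    using P q i(1,3) disj False unfolding P'_def segment_def
    by (simp add: successively_append_iff successively_Cons)
  moreover have "prefix P P'" "set P' = insert (d i) (set P \<union> set q)"
    by (simp_all add: P'_def)
  moreover have "set P' \<inter> W \<subseteq> set P \<union> set q" "set P \<union> set q \<subseteq> set P'"
    using i(3) by (auto simp: P'_def)
  ultimately show ?thesis
    by blast
qed

lemma forest_finite: "forest k F \<Longrightarrow> finite F"
  by (induction rule: forest.induct) auto

text \<open>Link \<open>P\<close> to the segment added last, keeping the linking vertex off the rest
  of the forest; the longer path then absorbs that rest by induction.\<close>

lemma forest_absorb:
  assumes "forest k F" "segment k P" "set P \<inter> F = {}"
  shows "\<exists>P'. segment k P' \<and> prefix P P' \<and> F \<subseteq> set P'"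
  using assms
proof (induction arbitrary: P rule: forest.induct)
  case empty
  then show ?case
    by auto
next
  case (add F q)
  have "set P \<inter> set q = {}"
    using add.prems by blast
  then obtain P' where P': "segment k P'" "prefix P P'" "set P \<union> set q \<subseteq> set P'" "set P' \<inter> F \<subseteq> set P \<union> set q"
    using segment_join[OF add.prems(1) add.hyps(2) _ forest_finite[OF add.hyps(1)]] by blast
  have "set P' \<inter> F = {}"
    using P'(4) add.prems add.hyps(3) by blast
  then obtain P'' where P'': "segment k P''" "prefix P' P''" "F \<subseteq> set P''"
    using add.IH[OF P'(1)] by blast
  have "prefix P P''"
    using P'(2) P''(2) by (rule prefix_order.trans)
  moreover have "set q \<union> F \<subseteq> set P''"
    using P'(3) P''(3) set_mono_prefix[OF P''(2)] by blast
  ultimately show ?case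
    using P''(1) by blast
qed

lemma forest_add_vertices:
  assumes "forest k F" "finite W" "W \<subseteq> color_class k"
  shows "forest k (F \<union> W)"
  using assms(2,3)
proof (induction W)
  case empty
  then show ?case
    using assms(1) by simp
next
  case (insert v W)
  show ?case
  proof (cases "v \<in> F \<union> W")
    case True
    then show ?thesis
      using insert by (simp add: insert_absorb)
  next
    case False
    have "forest k (set [v] \<union> (F \<union> W))"
      using insert False by (intro forest.add segment_singleton) auto
    then show ?thesis
      by simp
  qed
qed

section \<open>Forests in two-coloured bipartite graphs\<close>

text \<open>Alternate between \<open>Y\<close> and \<open>Z\<close>, starting and ending in
  \<open>Y\<close>; this takes one more vertex of \<open>Y\<close> than of \<open>Z\<close>. The
  clause \<open>hd P \<in> Y\<close> lets the induction prepend a further pair.\<close>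

lemma complete_bipartite_segment:
  assumes "finite Z" "finite Y" "card Z < card Y" "Y \<inter> Z = {}" "Y \<subseteq> color_class k" "0 \<notin> Z"
    and "\<forall>y\<in>Y. \<forall>z\<in>Z. c {y, z} = k"
  shows "\<exists>P. segment k P \<and> P \<noteq> [] \<and> hd P \<in> Y \<and> Z \<subseteq> set P \<and> set P \<subseteq> Y \<union> Z"
  using assms
proof (induction Z arbitrary: Y rule: finite_induct)
  case empty
  then obtain y where "y \<in> Y"
    by fastforce
  then show ?case
    using empty by (intro exI[of _ "[y]"]) (auto intro!: segment_singleton)
next
  case (insert z Z)
  then obtain y where y: "y \<in> Y"
    by fastforce
  have "card (Y - {y}) = card Y - 1"
    using y insert.prems by simp
  then have "card Z < card (Y - {y})"
    using insert by simp
  then have "\<exists>P. segment k P \<and> P \<noteq> [] \<and> hd P \<in> Y - {y} \<and> Z \<subseteq> set P \<and> set P \<subseteq> (Y - {y}) \<union> Z"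
    by (rule insert.IH[rotated]) (use insert.prems in auto)
  then obtain P where P: "segment k P" "P \<noteq> []" "hd P \<in> Y - {y}" "Z \<subseteq> set P" "set P \<subseteq> (Y - {y}) \<union> Z"
    by blast
  have "c {y, z} = k" "c {z, hd P} = k"
    using insert.prems y P(3) by (auto simp: insert_commute)
  then have "segment k (y # z # P)"
    using P y insert.prems insert.hyps by (auto simp: segment_def successively_Cons color_class_def)
  then show ?case
    using P y by (intro exI[of _ "y # z # P"]) auto
qed

lemma complete_bipartite_segment_min:
  assumes "finite Z" "finite Y" "Y \<inter> Z = {}" "Y \<subseteq> color_class k" "0 \<notin> Z"
    and "\<forall>y\<in>Y. \<forall>z\<in>Z. c {y, z} = k"
  shows "\<exists>P. segment k P \<and> set P \<subseteq> Y \<union> Z \<and> min (card Y - 1) (card Z) \<le> card (set P \<inter> Z)"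
proof (cases "Y = {}")
  case True
  then show ?thesis
    by (intro exI[of _ "[]"]) (simp add: segment_def)
next
  case False
  then have pos: "card Y > 0"
    using assms by (simp add: card_gt_0_iff)
  obtain Z' where Z': "Z' \<subseteq> Z" "card Z' = min (card Y - 1) (card Z)"
    by (meson min.cobounded2 obtain_subset_with_card_n)
  then have "card Z' < card Y"
    using pos by linarith
  moreover have "finite Z'"
    using Z' assms finite_subset by blast
  ultimately obtain P where P: "segment k P" "Z' \<subseteq> set P" "set P \<subseteq> Y \<union> Z'"
    using complete_bipartite_segment[of Z' Y k] Z' assms by (metis (no_types, opaque_lifting) disjoint_iff subset_iff)
  have "card Z' \<le> card (set P \<inter> Z)"
    using P Z' by (intro card_mono) auto
  then show ?thesis
    using P Z' by (intro exI[of _ P]) auto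
qed

text \<open>For a balanced depth-first search state in colour \<open>k\<close>, the stack is the path of colour \<open>k\<close>,
  and the pairs \<open>(D \<inter> A, U \<inter> C)\<close> and \<open>(U \<inter> A, D \<inter> C)\<close> are complete in colour \<open>l\<close> and almost
  balanced.\<close>

lemma bipartite_forests:
  assumes A: "finite A" "A \<subseteq> color_class k" and C: "finite C" "C \<subseteq> color_class l"
    and card: "card A = card C" and kl: "k \<noteq> l"
    and edges: "\<forall>u\<in>A. \<forall>v\<in>C. c {u, v} = k \<or> c {u, v} = l"
  shows "\<exists>F G. forest k F \<and> F \<subseteq> A \<union> C \<and> forest l G \<and> G \<subseteq> A \<union> C \<and>
    card A \<le> card (F \<inter> C) + card (G \<inter> A) + 6"
proof -
  have AC: "A \<inter> C = {}" "0 \<notin> A" "0 \<notin> C"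
    using color_class_disjoint[OF kl] zero_notin_color_class A(2) C(2) by blast+
  \<comment> \<open>The second conjunct restricts the search to edges between \<open>A\<close> and
    \<open>C\<close>, so that its stack alternates.\<close>
  define Q where "Q u v \<longleftrightarrow> c {u, v} = k \<and> (u \<in> A \<longleftrightarrow> v \<notin> A)" for u v
  have "dfs_state Q (A \<union> C) (A \<union> C) [] {}"
    by (simp add: dfs_state_def)
  then obtain U P D where st: "dfs_state Q (A \<union> C) U P D" and bal: "card (D \<inter> A) = card (U \<inter> C)"
    using dfs_balanced_state[of "A \<union> C" Q "A \<union> C" "[]" "{}" A C] A(1) C(1) by force
  have un: "A \<union> C = U \<union> set P \<union> D" and dj: "set P \<inter> D = {}" "set P \<inter> U = {}" "D \<inter> U = {}"
    and P: "distinct P" "successively Q P" and noQ: "\<forall>u\<in>U. \<forall>v\<in>D. \<not> Q u v"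
    using st by (auto simp: dfs_state_def)
  have fin: "finite U" "finite D"
    using un A C by (metis finite_Un)+
  have split: "card X = card (U \<inter> X) + card (set P \<inter> X) + card (D \<inter> X)" if "X \<subseteq> A \<union> C" for X
  proof -
    have "X = (U \<inter> X) \<union> (set P \<inter> X) \<union> (D \<inter> X)"
      using that un by auto
    moreover have "card ((U \<inter> X) \<union> (set P \<inter> X) \<union> (D \<inter> X)) = card (U \<inter> X) + card (set P \<inter> X) + card (D \<inter> X)"
      using fin dj by (subst card_Un_disjoint; (subst card_Un_disjoint)?) auto
    ultimately show ?thesis
      by simp
  qed
  have alt: "successively (\<lambda>u v. u \<in> A \<longleftrightarrow> v \<notin> A) P"
    using P(2) by (rule successively_mono) (auto simp: Q_def)
  have "length (filter (\<lambda>v. v \<in> A) P) = card (set P \<inter> A)" "length (filter (\<lambda>v. v \<notin> A) P) = card (set P \<inter> C)"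
  proof -
    have "{v. v \<notin> A} \<inter> set P = set P \<inter> C" "{v. v \<in> A} \<inter> set P = set P \<inter> A"
      using un AC by auto
    then show "length (filter (\<lambda>v. v \<in> A) P) = card (set P \<inter> A)" "length (filter (\<lambda>v. v \<notin> A) P) = card (set P \<inter> C)"
      using P(1) by (simp_all add: distinct_length_filter)
  qed
  then have diff: "card (set P \<inter> A) \<le> card (set P \<inter> C) + 1" "card (set P \<inter> C) \<le> card (set P \<inter> A) + 1"
    using alternating_count[OF alt] by linarith+
  obtain P' where P': "sublist P' P" "P' \<noteq> [] \<longrightarrow> hd P' \<in> A \<and> last P' \<in> A"
    "card (set P \<inter> C) \<le> card (set P' \<inter> C) + 2"
    using trim_alternating[OF alt P(1), of C] un AC by blast
  have sub: "set P' \<subseteq> A \<union> C"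
    using P'(1) un set_mono_sublist by blast
  have "segment k P'"
  proof -
    obtain xs ys where "P = xs @ P' @ ys"
      using P'(1) by (auto simp: sublist_def)
    then have "distinct P'" "successively Q P'"
      using P by (auto simp: successively_append_iff)
    moreover have "successively (\<lambda>u v. c {u, v} = k) P'"
      using \<open>successively Q P'\<close> by (rule successively_mono) (auto simp: Q_def)
    ultimately show ?thesis
      using P'(2) sub AC A unfolding segment_def by blast
  qed
  then have F: "forest k (set P')"
    using forest.add[OF forest.empty] by auto
  have blue: "c {u, v} = l" if "u \<in> U" "v \<in> D" "u \<in> A \<longleftrightarrow> v \<notin> A" for u v
  proof -
    have "c {u, v} \<noteq> k"
      using noQ that by (auto simp: Q_def)
    moreover have "u \<in> A \<and> v \<in> C \<or> v \<in> A \<and> u \<in> C"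
      using that un by blast
    ultimately show ?thesis
      using edges by (metis insert_commute)
  qed
  \<comment> \<open>The path \<open>p1\<close> has its ends in class \<open>l\<close> and absorbs
    vertices of \<open>D \<inter> A\<close>; \<open>p2\<close> does the same for
    \<open>U \<inter> A\<close>, using \<open>D \<inter> C\<close>.\<close>
  obtain p1 where p1: "segment l p1" "set p1 \<subseteq> (U \<inter> C) \<union> (D \<inter> A)"
    "min (card (U \<inter> C) - 1) (card (D \<inter> A)) \<le> card (set p1 \<inter> (D \<inter> A))"
    using complete_bipartite_segment_min[of "D \<inter> A" "U \<inter> C" l] blue AC A C fin by blast
  have "\<forall>y\<in>D \<inter> C. \<forall>z\<in>U \<inter> A. c {y, z} = l"
    using blue AC by (metis Int_iff disjoint_iff insert_commute)
  then obtain p2 where p2: "segment l p2" "set p2 \<subseteq> (D \<inter> C) \<union> (U \<inter> A)"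
    "min (card (D \<inter> C) - 1) (card (U \<inter> A)) \<le> card (set p2 \<inter> (U \<inter> A))"
    using complete_bipartite_segment_min[of "U \<inter> A" "D \<inter> C" l] AC A C fin by blast
  have "set p2 \<inter> set p1 = {}"
    using p1(2) p2(2) dj AC by blast
  then have G: "forest l (set p2 \<union> set p1)"
    using forest.add[OF forest.add[OF forest.empty p1(1)] p2(1)] by simp
  have "card (set p1 \<inter> (D \<inter> A)) + card (set p2 \<inter> (U \<inter> A)) = card ((set p1 \<inter> (D \<inter> A)) \<union> (set p2 \<inter> (U \<inter> A)))"
    using dj by (intro card_Un_disjoint[symmetric]) auto
  also have "\<dots> \<le> card ((set p2 \<union> set p1) \<inter> A)"
    by (intro card_mono) auto
  \<comment> \<open>The loss 6 is 3 + 1 + 2. The stack has at most one more vertex in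
    \<open>A\<close> than in \<open>C\<close>, and trimming costs two; \<open>p1\<close> misses at
    most one vertex of \<open>D \<inter> A\<close>; \<open>p2\<close> misses at most two of
    \<open>U \<inter> A\<close>, whose size differs from that of \<open>D \<inter> C\<close> by at
    most one.\<close>
  finally have "card A \<le> card (set P' \<inter> C) + card ((set p2 \<union> set p1) \<inter> A) + 6"
    using p1(3) p2(3) P'(3) diff bal split[of A] split[of C] card by auto
  moreover have "set p2 \<union> set p1 \<subseteq> A \<union> C"
    using p1(2) p2(2) by blast
  ultimately show ?thesis
    using F G sub by blast
qed

section \<open>Dense forests\<close>

lemma color_count:
  assumes "k < 2" "l < 2" "k \<noteq> l"
  shows "card (color_class k \<inter> {1..n}) + card (color_class l \<inter> {1..n}) = n"
proof -
  have "k = 0 \<and> l = 1 \<or> k = 1 \<and> l = 0"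
    using assms by linarith
  then have "color_class k \<union> color_class l = {0<..}"
    using color_class_cover by (metis Un_commute)
  moreover have "{0<..} \<inter> {1..n} = {1..n}"
    by auto
  ultimately have "(color_class k \<inter> {1..n}) \<union> (color_class l \<inter> {1..n}) = {1..n}"
    by (metis Int_Un_distrib2)
  moreover have "card ((color_class k \<inter> {1..n}) \<union> (color_class l \<inter> {1..n})) =
      card (color_class k \<inter> {1..n}) + card (color_class l \<inter> {1..n})"
    using color_class_disjoint[OF assms(3)] by (intro card_Un_disjoint) auto
  ultimately show ?thesis
    by simp
qed

text \<open>\<open>S\<close> stands for the vertices already occupied by a path under construction.
  \<open>F\<close> may reach beyond \<open>n\<close>, but only its part up to \<open>n\<close> is
  counted.\<close>

definition dense_forest :: "real \<Rightarrow> nat set \<Rightarrow> nat \<Rightarrow> nat \<Rightarrow> nat set \<Rightarrow> bool"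
  where "dense_forest \<epsilon> S k n F \<longleftrightarrow>
    forest k F \<and> F \<inter> S = {} \<and> (3 / 4 - \<epsilon>) * real n \<le> real (card (F \<inter> {1..n}))"

lemma dense_forest_majority:
  assumes "finite S" "3 * real n \<le> 4 * real (card (color_class k \<inter> {1..n}))" "real (card S) \<le> \<epsilon> * real n"
  shows "\<exists>F. dense_forest \<epsilon> S k n F"
proof -
  define F where "F = color_class k \<inter> {1..n} - S"
  have "forest k ({} \<union> F)"
    by (intro forest_add_vertices forest.empty) (auto simp: F_def)
  moreover have "card (color_class k \<inter> {1..n}) - card S \<le> card (F \<inter> {1..n})"
    using diff_card_le_card_Diff[OF assms(1), of "color_class k \<inter> {1..n}"]
    by (auto simp: F_def intro: order_trans card_mono)
  then have "real (card (color_class k \<inter> {1..n})) - real (card S) \<le> real (card (F \<inter> {1..n}))"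
    by linarith
  then have "(3 / 4 - \<epsilon>) * real n \<le> real (card (F \<inter> {1..n}))"
    using assms(2,3) by (simp add: left_diff_distrib)
  ultimately show ?thesis
    by (auto simp: dense_forest_def F_def)
qed

lemma dense_forest_balanced:
  assumes kl: "k < 2" "l < 2" "k \<noteq> l" and nm: "n \<le> m" and S: "finite S" and eps: "\<epsilon> > 0"
    and bal: "card (color_class k \<inter> {1..m}) = card (color_class l \<inter> {1..n})"
    and ineq: "3 * real n \<le> real m + 4 * real (card (color_class k \<inter> {1..n})) + \<epsilon> * real n"
    and large: "3 * real (card S) + 6 \<le> \<epsilon> * real n"
  shows "(\<exists>F. dense_forest \<epsilon> S k n F) \<or> (\<exists>F. dense_forest \<epsilon> S l m F)"
proof -
  define s where "s = card (color_class l \<inter> {1..n})"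
  define A' where "A' = color_class k \<inter> {1..m} - S"
  define C' where "C' = color_class l \<inter> {1..n} - S"
  have "s - card S \<le> card A'" "s - card S \<le> card C'"
    unfolding s_def A'_def C'_def using bal diff_card_le_card_Diff[OF S] by metis+
  \<comment> \<open>Removing \<open>S\<close> may shrink the two classes unequally; both are cut
    down to the common size that \<open>bipartite_forests\<close> asks for.\<close>
  then obtain A C where A: "A \<subseteq> A'" "card A = s - card S" and C: "C \<subseteq> C'" "card C = s - card S"
    by (metis obtain_subset_with_card_n)
  have fin: "finite A" "finite C"
    using A(1) C(1) by (auto simp: A'_def C'_def intro: finite_subset)
  have sub: "A \<subseteq> color_class k" "C \<subseteq> color_class l"
    using A(1) C(1) by (auto simp: A'_def C'_def)
  have "\<forall>u\<in>A. \<forall>v\<in>C. c {u, v} = k \<or> c {u, v} = l"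
  proof (intro ballI)
    fix u v assume uv: "u \<in> A" "v \<in> C"
    then have "u \<in> color_class k" "v \<in> color_class l"
      using sub by auto
    then have "0 < u" "0 < v" "u \<noteq> v"
      using color_class_disjoint[OF kl(3)] by (auto simp: color_class_def)
    then show "c {u, v} = k \<or> c {u, v} = l"
      using color_less[of u v] kl by linarith
  qed
  then obtain F G where F: "forest k F" "F \<subseteq> A \<union> C" and G: "forest l G" "G \<subseteq> A \<union> C"
    and sum: "card A \<le> card (F \<inter> C) + card (G \<inter> A) + 6"
    using bipartite_forests[OF fin(1) sub(1) fin(2) sub(2) _ kl(3)] A(2) C(2) by metis
  define F' where "F' = F \<union> (color_class k \<inter> {1..m} - S)"
  define G' where "G' = G \<union> (color_class l \<inter> {1..m} - S)"
  have "forest k F'" "forest l G'"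
    unfolding F'_def G'_def using F G by (auto intro!: forest_add_vertices)
  have "F' \<inter> S = {}" "G' \<inter> S = {}"
    using F(2) G(2) A(1) C(1) by (auto simp: F'_def G'_def A'_def C'_def)
  have disj: "color_class k \<inter> color_class l = {}"
    by (rule color_class_disjoint[OF kl(3)])
  have cardF: "card (F \<inter> C) + (card (color_class k \<inter> {1..n}) - card S) \<le> card (F' \<inter> {1..n})"
  proof -
    have "card (F \<inter> C) + (card (color_class k \<inter> {1..n}) - card S)
        \<le> card (F \<inter> C) + card (color_class k \<inter> {1..n} - S)"
      using diff_card_le_card_Diff[OF S] by simp
    also have "\<dots> = card ((F \<inter> C) \<union> (color_class k \<inter> {1..n} - S))"
      using disj C(1) fin by (intro card_Un_disjoint[symmetric]) (auto simp: C'_def)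
    also have "\<dots> \<le> card (F' \<inter> {1..n})"
      using C(1) nm by (intro card_mono) (auto simp: C'_def F'_def)
    finally show ?thesis .
  qed
  have cardG: "card (G \<inter> A) + (card (color_class l \<inter> {1..m}) - card S) \<le> card (G' \<inter> {1..m})"
  proof -
    have "card (G \<inter> A) + (card (color_class l \<inter> {1..m}) - card S)
        \<le> card (G \<inter> A) + card (color_class l \<inter> {1..m} - S)"
      using diff_card_le_card_Diff[OF S] by simp
    also have "\<dots> = card ((G \<inter> A) \<union> (color_class l \<inter> {1..m} - S))"
      using disj A(1) fin by (intro card_Un_disjoint[symmetric]) (auto simp: A'_def)
    also have "\<dots> \<le> card (G' \<inter> {1..m})"
      using A(1) by (intro card_mono) (auto simp: A'_def G'_def)
    finally show ?thesis .
  qed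
  have "card (color_class k \<inter> {1..n}) + s = n" "s + card (color_class l \<inter> {1..m}) = m"
    using color_count[OF kl, of n] color_count[OF kl, of m] bal by (simp_all add: s_def)
  moreover have "\<epsilon> * real n \<le> \<epsilon> * real m"
    using nm eps by (intro mult_left_mono) auto
  \<comment> \<open>With \<open>a\<close> vertices of class \<open>k\<close> up to \<open>n\<close>,
    the two forests together count at least \<open>a + m - 3 * card S - 6\<close>. By
    \<open>ineq\<close> and \<open>large\<close> this is at least
    \<open>(3 / 4 - \<epsilon>) * (n + m)\<close>, so one of the two bounds holds.\<close>
  ultimately have "(3 / 4 - \<epsilon>) * real n \<le> real (card (F' \<inter> {1..n})) \<or>
      (3 / 4 - \<epsilon>) * real m \<le> real (card (G' \<inter> {1..m}))"
    using cardF cardG sum A(2) ineq large unfolding left_diff_distrib by linarith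
  then show ?thesis
    using \<open>forest k F'\<close> \<open>forest l G'\<close> \<open>F' \<inter> S = {}\<close> \<open>G' \<inter> S = {}\<close> unfolding dense_forest_def by blast
qed

lemma exists_dense_forest:
  assumes "\<epsilon> > 0" "finite S"
  shows "\<exists>k<2. \<exists>n\<ge>N. \<exists>F. dense_forest \<epsilon> S k n F"
proof -
  \<comment> \<open>Beyond \<open>M\<close> the errors from \<open>S\<close> and the constant 6 are
    at most \<open>\<epsilon> * n\<close>; \<open>Suc N\<close> makes \<open>M\<close>
    positive.\<close>
  define M where "M = max (Suc N) (nat \<lceil>(3 * real (card S) + 6) / \<epsilon>\<rceil>)"
  have large: "3 * real (card S) + 6 \<le> \<epsilon> * real n" if "M \<le> n" for n
  proof -
    have "(3 * real (card S) + 6) / \<epsilon> \<le> real M"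
      unfolding M_def by linarith
    then have "(3 * real (card S) + 6) / \<epsilon> \<le> real n"
      using that by linarith
    then show ?thesis
      using assms(1) by (simp add: pos_divide_le_eq mult.commute)
  qed
  then have small: "real (card S) \<le> \<epsilon> * real n" if "M \<le> n" for n
    using large[OF that] by linarith
  have M: "M > 0" "N \<le> M"
    by (auto simp: M_def)
  have mono: "mono (\<lambda>n. card (color_class k \<inter> {1..n}))" for k
    by (intro monoI card_mono) auto
  consider n where "M \<le> n" "3 * real n \<le> 4 * real (card (color_class 0 \<inter> {1..n}))"
    | n where "M \<le> n" "3 * real n \<le> 4 * real (card (color_class 1 \<inter> {1..n}))"
    | n m where "M \<le> n" "n \<le> m" "card (color_class 0 \<inter> {1..m}) = card (color_class 1 \<inter> {1..n})"
      "3 * real n \<le> real m + 4 * real (card (color_class 0 \<inter> {1..n})) + \<epsilon> * real n"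
    | n m where "M \<le> n" "n \<le> m" "card (color_class 1 \<inter> {1..m}) = card (color_class 0 \<inter> {1..n})"
      "3 * real n \<le> real m + 4 * real (card (color_class 1 \<inter> {1..n})) + \<epsilon> * real n"
    using balanced_index_cases[OF color_count[of 0 1] mono mono assms(1) M(1)] by auto
  then show ?thesis
  proof cases
    case (1 n)
    then show ?thesis
      using dense_forest_majority[OF assms(2) 1(2) small] M(2) by (meson le_trans pos2)
  next
    case (2 n)
    then show ?thesis
      using dense_forest_majority[OF assms(2) 2(2) small] M(2) by (meson le_trans one_less_numeral_iff semiring_norm(76))
  next
    case (3 n m)
    have "(\<exists>F. dense_forest \<epsilon> S 0 n F) \<or> (\<exists>F. dense_forest \<epsilon> S 1 m F)"
      using 3 assms large by (intro dense_forest_balanced) auto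
    moreover have "N \<le> n" "N \<le> m"
      using 3 M(2) by auto
    ultimately show ?thesis
      by (meson one_less_numeral_iff pos2 semiring_norm(76))
  next
    case (4 n m)
    have "(\<exists>F. dense_forest \<epsilon> S 1 n F) \<or> (\<exists>F. dense_forest \<epsilon> S 0 m F)"
      using 4 assms large by (intro dense_forest_balanced) auto
    moreover have "N \<le> n" "N \<le> m"
      using 4 M(2) by auto
    ultimately show ?thesis
      by (meson one_less_numeral_iff pos2 semiring_norm(76))
  qed
qed

lemma dense_forest_antimono:
  assumes "dense_forest \<epsilon> S k n F" "\<epsilon> \<le> \<epsilon>'" "S' \<subseteq> S"
  shows "dense_forest \<epsilon>' S' k n F"
proof -
  have "(3 / 4 - \<epsilon>') * real n \<le> (3 / 4 - \<epsilon>) * real n"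
    using assms(2) by (intro mult_right_mono) auto
  then show ?thesis
    using assms unfolding dense_forest_def by (meson disjoint_iff order_trans subsetD)
qed

text \<open>The colour found so far may vary with the parameters. If each colour failed for some
  parameters, the smaller \<open>\<epsilon>\<close>, the union of the sets and the larger bound
  would defeat both colours at once.\<close>

lemma exists_dense_color:
  "\<exists>k. \<forall>\<epsilon>>0. \<forall>S N. finite S \<longrightarrow> (\<exists>n\<ge>N. \<exists>F. dense_forest \<epsilon> S k n F)"
proof (rule ccontr)
  assume neg: "\<not> ?thesis"
  obtain \<epsilon> S N where *: "\<epsilon> > 0" "finite S" "\<not> (\<exists>n\<ge>N. \<exists>F. dense_forest \<epsilon> S 0 n F)"
    using neg by blast
  obtain \<epsilon>' S' N' where **: "\<epsilon>' > 0" "finite S'" "\<not> (\<exists>n\<ge>N'. \<exists>F. dense_forest \<epsilon>' S' 1 n F)"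
    using neg by blast
  obtain k n F where k: "k < 2" and n: "n \<ge> max N N'" and F: "dense_forest (min \<epsilon> \<epsilon>') (S \<union> S') k n F"
    using exists_dense_forest[of "min \<epsilon> \<epsilon>'" "S \<union> S'" "max N N'"] * ** by auto
  from k consider "k = 0" | "k = 1"
    by linarith
  then show False
  proof cases
    case 1
    then have "dense_forest \<epsilon> S 0 n F"
      using dense_forest_antimono[OF F] by simp
    then show False
      using *(3) n by auto
  next
    case 2
    then have "dense_forest \<epsilon>' S' 1 n F"
      using dense_forest_antimono[OF F] by simp
    then show False
      using **(3) n by auto
  qed
qed

section \<open>Assembling the infinite path\<close>

text \<open>The error \<open>1 / (i + 4)\<close> tends to 0 and never exceeds 1/4, so each step
  reaches density at least 1/2 in some \<open>{1..n}\<close>.\<close>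

definition dense_step :: "nat \<Rightarrow> nat list \<Rightarrow> nat list \<Rightarrow> bool"
  where "dense_step i P P' \<longleftrightarrow> prefix P P' \<and>
    (\<exists>n\<ge>Suc i. (3 / 4 - 1 / real (i + 4)) * real n \<le> real (card (set P' \<inter> {1..n})))"

lemma exists_dense_segments:
  "\<exists>k L. \<forall>i. (segment k (L i) \<and> i \<le> length (L i)) \<and> dense_step i (L i) (L (Suc i))"
proof -
  obtain k where k: "\<forall>\<epsilon>>0. \<forall>S N. finite S \<longrightarrow> (\<exists>n\<ge>N. \<exists>F. dense_forest \<epsilon> S k n F)"
    using exists_dense_color by (elim exE)
  have "\<exists>L. \<forall>i. (segment k (L i) \<and> i \<le> length (L i)) \<and> dense_step i (L i) (L (Suc i))"
  proof (rule dependent_nat_choice[where P = "\<lambda>i P. segment k P \<and> i \<le> length P" and Q = dense_step])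
    show "\<exists>P. segment k P \<and> 0 \<le> length P"
      by (intro exI[of _ "[]"]) (simp add: segment_def)
  next
    fix P i assume P: "segment k P \<and> i \<le> length P"
    \<comment> \<open>Density 1/2 in \<open>{1..n}\<close> with \<open>n \<ge> 2 * Suc i\<close>
      gives at least \<open>Suc i\<close> vertices, which forces the lists to grow.\<close>
    have "\<exists>n\<ge>2 * Suc i. \<exists>F. dense_forest (1 / real (i + 4)) (set P) k n F"
      by (rule k[rule_format]) auto
    then obtain n F where n: "n \<ge> 2 * Suc i" and F: "dense_forest (1 / real (i + 4)) (set P) k n F"
      by blast
    have "forest k F" "set P \<inter> F = {}"
      using F by (auto simp: dense_forest_def)
    then obtain P' where P': "segment k P'" "prefix P P'" "F \<subseteq> set P'"
      using forest_absorb P by blast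
    have "card (F \<inter> {1..n}) \<le> card (set P' \<inter> {1..n})"
      using P'(3) by (intro card_mono) auto
    then have dense: "(3 / 4 - 1 / real (i + 4)) * real n \<le> real (card (set P' \<inter> {1..n}))"
      using F unfolding dense_forest_def by linarith
    have "1 / real (i + 4) \<le> 1 / 4"
      by (rule divide_left_mono) auto
    then have "1 / 2 \<le> 3 / 4 - 1 / real (i + 4)"
      by linarith
    then have "1 / 2 * real n \<le> (3 / 4 - 1 / real (i + 4)) * real n"
      by (rule mult_right_mono) simp
    moreover have "real (2 * Suc i) \<le> real n"
      using n by (simp only: of_nat_le_iff)
    then have "real (Suc i) \<le> 1 / 2 * real n"
      by simp
    ultimately have "real (Suc i) \<le> real (card (set P' \<inter> {1..n}))"
      using dense by (meson order_trans)
    then have "Suc i \<le> card (set P' \<inter> {1..n})"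
      by (simp only: of_nat_le_iff)
    also have "\<dots> \<le> length P'"
      using card_mono[of "set P'" "set P' \<inter> {1..n}"] card_length[of P'] by auto
    finally have "Suc i \<le> length P'" .
    moreover have "n \<ge> Suc i"
      using n by simp
    ultimately show "\<exists>P'. (segment k P' \<and> Suc i \<le> length P') \<and> dense_step i P P'"
      using P'(1,2) dense unfolding dense_step_def by blast
  qed
  then show ?thesis ..
qed

end

text \<open>For \<open>i \<ge> N\<close> the witness \<open>n\<close> lies beyond \<open>N\<close>,
  so the supremum over that tail is at least \<open>a - 1 / (i + 4)\<close>; let \<open>i\<close>
  tend to infinity.\<close>

lemma upper_density_ge:
  assumes "\<And>i. \<exists>n\<ge>Suc i. (a - 1 / real (i + 4)) * real n \<le> real (card (A \<inter> {1..n}))"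
  shows "ereal a \<le> upper_density A"
  unfolding upper_density_def limsup_INF_SUP
proof (rule INF_greatest)
  fix N
  let ?f = "\<lambda>n. ereal (real (card (A \<inter> {1..n})) / real n)"
  have le: "ereal (a - 1 / real (i + 4)) \<le> (SUP n\<in>{N..}. ?f n)" if "i \<ge> N" for i
  proof -
    obtain n where n: "n \<ge> Suc i" "(a - 1 / real (i + 4)) * real n \<le> real (card (A \<inter> {1..n}))"
      using assms by blast
    then have "ereal (a - 1 / real (i + 4)) \<le> ?f n"
      by (simp add: pos_le_divide_eq)
    also have "\<dots> \<le> (SUP n\<in>{N..}. ?f n)"
      using n that by (intro SUP_upper) auto
    finally show ?thesis .
  qed
  have "(\<lambda>i. 1 / real (i + 4)) \<longlonglongrightarrow> 0"
    using LIMSEQ_ignore_initial_segment[OF lim_1_over_n, of 4] by simp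
  then have "(\<lambda>i. a - 1 / real (i + 4)) \<longlonglongrightarrow> a - 0"
    by (intro tendsto_diff tendsto_const)
  then have "(\<lambda>i. ereal (a - 1 / real (i + 4))) \<longlonglongrightarrow> ereal a"
    by simp
  then show "ereal a \<le> (SUP n\<in>{N..}. ?f n)"
    by (rule LIMSEQ_le_const2) (use le in blast)
qed

theorem theorem1p6:
  fixes c :: "nat set \<Rightarrow> nat"
  assumes "edge_coloring 2 KN_edges c"
  shows "\<exists>x. KN_path x \<and> monochromatic_edges c (path_edges x) \<and> upper_density (path_vertices x) \<ge> 3 / 4"
proof -
  obtain d where d: "strict_mono d"
    "\<forall>v. (\<forall>\<^sub>F i in sequentially. c {v, d i} = 0) \<or> (\<forall>\<^sub>F i in sequentially. c {v, d i} \<noteq> 0)"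
    using exists_cohesive_sequence[of "\<lambda>v w. c {v, w} = 0"] by blast
  interpret cohesive_coloring c d
  proof
    fix u v :: nat assume "0 < u" "0 < v" "u \<noteq> v"
    then have "{u, v} \<in> KN_edges"
      by (auto simp: KN_edges_def KN_vertices_def nsets_def)
    then show "c {u, v} < 2"
      using assms by (auto simp: edge_coloring_def)
  qed (use d in blast)+
  obtain k L where kL: "\<forall>i. (segment k (L i) \<and> i \<le> length (L i)) \<and> dense_step i (L i) (L (Suc i))"
    using exists_dense_segments by (elim exE)
  then have seg: "segment k (L i)" and len: "i \<le> length (L i)" and step: "dense_step i (L i) (L (Suc i))" for i
    by blast+
  have pre: "prefix (L i) (L (Suc i))" for i
    using step by (simp add: dense_step_def)
  have prefix: "prefix (L i) (L j)" if "i \<le> j" for i j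
    using that
  proof (induction rule: dec_induct)
    case (step j)
    then show ?case
      using pre[of j] prefix_order.trans by blast
  qed simp
  have nth: "L j ! m = L i ! m" if "i \<le> j" "m < length (L i)" for i j m
    using prefix[OF that(1)] that(2) by (auto simp: prefix_def nth_append)
  \<comment> \<open>The limit of the prefix chain, read off at \<open>L (Suc m)\<close>, whose
    length is guaranteed to exceed \<open>m\<close>.\<close>
  define x where "x m = L (Suc m) ! m" for m
  have x: "x m = L i ! m" if "m < i" for i m
    unfolding x_def using nth[of "Suc m" i m] len[of "Suc m"] that by simp
  have in_L: "m < length (L i)" if "m < i" for i m
    using len[of i] that by simp
  have "x m \<noteq> x m'" if "m \<noteq> m'" for m m'
  proof -
    let ?i = "Suc (max m m')"
    have "distinct (L ?i)"
      using seg by (simp add: segment_def)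
    then show ?thesis
      using that x[of m ?i] x[of m' ?i] in_L[of m ?i] in_L[of m' ?i] by (simp add: nth_eq_iff_index_eq)
  qed
  then have "inj x"
    by (metis injI)
  moreover have "x m \<noteq> 0" for m
  proof -
    have "x m \<in> set (L (Suc m))"
      using in_L[of m "Suc m"] by (simp add: x_def)
    then show ?thesis
      using seg[of "Suc m"] by (metis segment_def)
  qed
  ultimately have "KN_path x"
    by (auto simp: KN_path_def KN_vertices_def Suc_le_eq)
  moreover have "c {x m, x (Suc m)} = k" for m
  proof -
    have "successively (\<lambda>u v. c {u, v} = k) (L (Suc (Suc m)))"
      using seg by (simp add: segment_def)
    then show ?thesis
      using in_L[of "Suc m" "Suc (Suc m)"] x[of m "Suc (Suc m)"] x[of "Suc m" "Suc (Suc m)"]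
      by (simp add: successively_conv_nth)
  qed
  then have "monochromatic_edges c (path_edges x)"
    by (auto simp: monochromatic_edges_def path_edges_def)
  moreover have "ereal (3 / 4) \<le> upper_density (path_vertices x)"
  proof (rule upper_density_ge)
    fix i
    have "set (L (Suc i)) \<subseteq> range x"
    proof
      fix v assume "v \<in> set (L (Suc i))"
      then obtain m where m: "m < length (L (Suc i))" "v = L (Suc i) ! m"
        by (metis in_set_conv_nth)
      then have "v = x m"
        using nth[of "Suc i" "max (Suc i) (Suc m)" m] x[of m "max (Suc i) (Suc m)"] by simp
      then show "v \<in> range x"
        by simp
    qed
    then have "card (set (L (Suc i)) \<inter> {1..n}) \<le> card (path_vertices x \<inter> {1..n})" for n
      unfolding path_vertices_def by (intro card_mono) auto
    then have card_le: "real (card (set (L (Suc i)) \<inter> {1..n})) \<le> real (card (path_vertices x \<inter> {1..n}))" for n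
      by (simp only: of_nat_le_iff)
    obtain n where "n \<ge> Suc i" "(3 / 4 - 1 / real (i + 4)) * real n \<le> real (card (set (L (Suc i)) \<inter> {1..n}))"
      using step[of i] unfolding dense_step_def by blast
    then show "\<exists>n\<ge>Suc i. (3 / 4 - 1 / real (i + 4)) * real n \<le> real (card (path_vertices x \<inter> {1..n}))"
      using card_le order_trans by blast
  qed
  moreover have "ereal (3 / 4) = 3 / 4"
    by simp
  ultimately show ?thesis
    by metis
qed

end
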